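(* Let $G$ be a graph on $n \geq 4$ vertices such that $d(x) + d(y) \geq n$ for every induced subgraph $H$ of $G$ isomorphic to one of $K_{1,2} \cup K_1$, $K_3 \cup K_1$, $K_{1,3}$, $K_{1,3} + e$, $P_4$, and for every pair of distinct nonadjacent vertices $x, y$ of $H$. If $G$ has a vertex $v$ with $d(v) \geq 2$, then $G$ is Hamiltonian.
   Context: All graphs are finite and undirected, with no loops or multiple edges. For a vertex $v$ of $G$, $d(v)$ denotes the degree of $v$ in $G$ (not in the induced subgraph). $K_m$ is the complete graph on $m$ vertices, $K_{m,n}$ is the complete bipartite graph with parts of sizes $m$ and $n$, $P_m$ is the simple path on $m$ vertices, $\cup$ denotes disjoint union of graphs, and $W + e$ denotes a graph obtained from $W$ by adding an edge $e$ joining two nonadjacent vertices of $W$. In particular $K_{1,3}+e$ is the graph (unique up to isomorphism) obtained from $K_{1,3}$ by adding an edge between two of its leaves. A graph is Hamiltonian if it contains a Hamilton cycle, i.e. a simple cycle passing through all vertices of the graph. (By the convention used, a single vertex and a single edge count as cycles of order 1 and 2, respectively; since $n \ge 4$ here, a Hamilton cycle is a spanning cycle in the usual sense.) *)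

theory Defs
  imports "Graph_Theory.Graph_Theory"
begin

text \<open>
  Finite simple undirected graphs are the finite, loop-free symmetric digraphs
  of \<^locale>\<open>pair_graph\<close>: an edge between \<open>u\<close> and \<open>v\<close> is the pair of arcs \<open>(u, v)\<close>
  and \<open>(v, u)\<close>. Hence the degree of a vertex is its \<^const>\<open>out_degree\<close>.
\<close>

definition complete_graph :: "nat \<Rightarrow> nat pair_pre_digraph" where
  "complete_graph m = \<lparr> pverts = {..<m}, parcs = {(i, j). i < m \<and> j < m \<and> i \<noteq> j} \<rparr>"

definition complete_bipartite_graph :: "nat \<Rightarrow> nat \<Rightarrow> (nat + nat) pair_pre_digraph" where
  "complete_bipartite_graph m n =
     \<lparr> pverts = {..<m} <+> {..<n},
       parcs = (Inl ` {..<m}) \<times> (Inr ` {..<n}) \<union> (Inr ` {..<n}) \<times> (Inl ` {..<m}) \<rparr>"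

definition path_graph :: "nat \<Rightarrow> nat pair_pre_digraph" where
  "path_graph m =
     \<lparr> pverts = {..<m}, parcs = {(i, j). i < m \<and> j < m \<and> (j = Suc i \<or> i = Suc j)} \<rparr>"

definition disjoint_union ::
    "'a pair_pre_digraph \<Rightarrow> 'b pair_pre_digraph \<Rightarrow> ('a + 'b) pair_pre_digraph" where
  "disjoint_union A B =
     \<lparr> pverts = pverts A <+> pverts B,
       parcs = map_prod Inl Inl ` parcs A \<union> map_prod Inr Inr ` parcs B \<rparr>"

definition edge_addition :: "'a pair_pre_digraph \<Rightarrow> 'a pair_pre_digraph \<Rightarrow> bool" where
  "edge_addition W W' \<longleftrightarrow>
     (\<exists>x \<in> pverts W. \<exists>y \<in> pverts W. x \<noteq> y \<and> (x, y) \<notin> parcs W \<and>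
        W' = \<lparr> pverts = pverts W, parcs = parcs W \<union> {(x, y), (y, x)} \<rparr>)"

text \<open>
  A single vertex counts as a cycle of order 1. A single edge counts as one of order 2,
  which \<^const>\<open>pre_digraph.cycle\<close> already provides (traverse the edge back and forth).
  Every vertex on a cycle is the tail of one of its arcs.
\<close>

definition hamiltonian :: "'a pair_pre_digraph \<Rightarrow> bool" where
  "hamiltonian G \<longleftrightarrow>
     card (pverts G) = 1 \<or>
     (\<exists>p. pre_digraph.cycle (with_proj G) p \<and> fst ` set p = pverts G)"

lemma complete_digraph_complete_graph: "complete_digraph m (with_proj (complete_graph m))"
  by (auto simp: complete_digraph_pair_def complete_graph_def)

lemma complete_bipartite_digraph_complete_bipartite_graph:
  "complete_bipartite_digraph m n (with_proj (complete_bipartite_graph m n))"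
  unfolding complete_bipartite_digraph_pair_def complete_bipartite_graph_def
  by (intro conjI exI[of _ "Inl ` {..<m}"] exI[of _ "Inr ` {..<n}"])
    (auto simp: card_image Plus_def)

lemma pair_graph_path_graph: "pair_graph (path_graph m)"
proof -
  have "parcs (path_graph m) \<subseteq> {..<m} \<times> {..<m}"
    by (auto simp: path_graph_def)
  then have "finite (parcs (path_graph m))"
    by (rule finite_subset) simp
  then show ?thesis
    by unfold_locales (auto simp: path_graph_def symmetric_def intro: symI)
qed

end

theory Submission
  imports Defs
begin

text \<open>
  The degree hypothesis looks only at certain induced subgraphs, but it already forces Ore's
  condition \<open>d(x) + d(y) \<ge> n\<close> for all pairs of distinct nonadjacent vertices
  (\<open>degree_sum_nonadjacent\<close>), so that Ore's theorem (\<open>ore\<close>) applies.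

  Suppose that \<open>x\<close> and \<open>y\<close> are nonadjacent with \<open>d(x) + d(y) < n\<close>. Whatever two further
  vertices are added, the four vertices then induce none of the five listed graphs. The other
  graphs on four vertices are \<open>4 K\<^sub>1\<close>, \<open>K\<^sub>2 \<union> 2 K\<^sub>1\<close>, \<open>2 K\<^sub>2\<close>, \<open>C\<^sub>4\<close>, \<open>K\<^sub>4\<close> minus an edge and \<open>K\<^sub>4\<close>.
  This is very restrictive. If \<open>x\<close> and \<open>y\<close> have a common neighbour, every other vertex must be a
  common neighbour too, and \<open>d(x) + d(y) = 2(n - 2) \<ge> n\<close>, a contradiction. Otherwise \<open>x\<close> and \<open>y\<close>
  have at most one neighbour each, and such a neighbour has no other neighbours. A vertex \<open>v\<close> of
  degree at least 2 therefore lies, with its neighbours, in components that avoid \<open>x\<close> and \<open>y\<close>. Now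
  \<open>v\<close>, two of its neighbours and \<open>x\<close> induce \<open>K\<^sub>1\<^sub>,\<^sub>2 \<union> K\<^sub>1\<close> or \<open>K\<^sub>3 \<union> K\<^sub>1\<close>, so the hypothesis gives
  \<open>n \<le> d(x) + d(v) \<le> 1 + (n - 3)\<close>, which is absurd.

  Ore's theorem is proved by taking a cyclic ordering of the vertices with as few gaps
  (consecutive nonadjacent vertices) as possible. If there were a gap, the degree sum at its ends
  would provide two crossing chords, and reversing the segment between them would give an ordering
  with fewer gaps (\<open>gaps_reverse_less\<close>, \<open>crossing_chords\<close>).
\<close>

section \<open>Ore's theorem\<close>

definition misses :: "'a rel \<Rightarrow> 'a list \<Rightarrow> nat" where
  "misses R p = length (filter (\<lambda>e. e \<notin> R) (vwalk_arcs p))"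

text \<open>
  A list without repetitions that enumerates all vertices is read as a cyclic ordering, so the
  step from its last element back to its first counts as well. The ordering is a Hamilton cycle
  when it has no gaps.
\<close>

definition gaps :: "'a rel \<Rightarrow> 'a list \<Rightarrow> nat" where
  "gaps R l = misses R (l @ [hd l])"

lemma gaps_append:
  assumes "P \<noteq> []" "Q \<noteq> []"
  shows "gaps R (P @ Q) = misses R P + misses R Q
    + of_bool ((last P, hd Q) \<notin> R) + of_bool ((last Q, hd P) \<notin> R)"
  using assms by (simp add: gaps_def misses_def vwalk_arcs_append)

lemma gaps_rotate:
  assumes "P \<noteq> []" "Q \<noteq> []"
  shows "gaps R (Q @ P) = gaps R (P @ Q)"
  using assms by (simp add: gaps_append)

lemma vwalk_arcs_rev: "vwalk_arcs (rev p) = rev (map prod.swap (vwalk_arcs p))"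
proof (induction p rule: vwalk_arcs.induct)
  case (3 x y xs)
  have "vwalk_arcs (rev (x # y # xs)) = vwalk_arcs (rev (y # xs)) @ [(y, x)]"
    using vwalk_arcs_append[of "rev (y # xs)" "[x]"] by simp
  with 3 show ?case by simp
qed simp_all

lemma misses_rev:
  assumes "sym R"
  shows "misses R (rev p) = misses R p"
proof -
  have "prod.swap e \<in> R \<longleftrightarrow> e \<in> R" for e
    using assms by (cases e) (auto dest: symD)
  then show ?thesis
    by (simp add: misses_def vwalk_arcs_rev rev_filter[symmetric] filter_map comp_def)
qed

text \<open>
  The exchange step: reversing \<open>Q\<close> changes only the two steps between \<open>P\<close> and \<open>Q\<close>. They become
  the two chords, both of which are present, while one of the steps given up was a gap.
\<close>

lemma gaps_reverse_less:
  assumes "sym R" "P \<noteq> []" "Q \<noteq> []"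
    and "(last Q, hd P) \<notin> R" "(hd P, hd Q) \<in> R" "(last P, last Q) \<in> R"
  shows "gaps R (P @ rev Q) < gaps R (P @ Q)"
  using assms
  by (auto simp: gaps_append misses_rev hd_rev last_rev dest: symD)

text \<open>
  Pigeonhole argument. A neighbour of the first vertex determines the step that enters it,
  and a neighbour of the last vertex determines the step that leaves it. There are only \<open>length l - 1\<close> steps inside the list, so some step is determined twice, and the
  list is cut at this step.
\<close>

lemma crossing_chords:
  assumes "distinct l" "R \<subseteq> set l \<times> set l" "sym R" "irrefl R" "l \<noteq> []"
    and deg: "card (R `` {hd l}) + card (R `` {last l}) \<ge> length l"
  obtains P Q where "l = P @ Q" "P \<noteq> []" "Q \<noteq> []" "(hd P, hd Q) \<in> R" "(last P, last Q) \<in> R"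
proof -
  define n where "n = length l"
  have hd: "hd l = l ! 0" and last: "last l = l ! (n - 1)"
    using \<open>l \<noteq> []\<close> by (simp_all add: hd_conv_nth last_conv_nth n_def)
  define A where "A = {i. Suc i < n \<and> (hd l, l ! Suc i) \<in> R}"
  define B where "B = {i. Suc i < n \<and> (last l, l ! i) \<in> R}"
  have sub: "A \<subseteq> {..<n - 1}" "B \<subseteq> {..<n - 1}"
    by (auto simp: A_def B_def)
  then have fin: "finite A" "finite B"
    by (auto intro: finite_subset)
  have "R `` {hd l} \<subseteq> (\<lambda>i. l ! Suc i) ` A"
  proof
    fix z assume z: "z \<in> R `` {hd l}"
    with assms(2) have "z \<in> set l" by blast
    then obtain j where j: "j < n" "z = l ! j"
      by (auto simp: in_set_conv_nth n_def)
    with z hd \<open>irrefl R\<close> obtain i where "j = Suc i"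
      by (cases j) (auto simp: irrefl_def)
    with j z show "z \<in> (\<lambda>i. l ! Suc i) ` A"
      by (auto simp: A_def)
  qed
  with fin have cA: "card (R `` {hd l}) \<le> card A"
    by (meson card_image_le card_mono finite_imageI order_trans)
  have "R `` {last l} \<subseteq> (\<lambda>i. l ! i) ` B"
  proof
    fix z assume z: "z \<in> R `` {last l}"
    with assms(2) have "z \<in> set l" by blast
    then obtain j where j: "j < n" "z = l ! j"
      by (auto simp: in_set_conv_nth n_def)
    with z last \<open>irrefl R\<close> have "j \<noteq> n - 1"
      by (auto simp: irrefl_def)
    with j z show "z \<in> (\<lambda>i. l ! i) ` B"
      by (auto simp: B_def)
  qed
  with fin have cB: "card (R `` {last l}) \<le> card B"
    by (meson card_image_le card_mono finite_imageI order_trans)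
  have "A \<inter> B \<noteq> {}"
  proof
    assume "A \<inter> B = {}"
    with fin have "card A + card B = card (A \<union> B)"
      by (simp add: card_Un_disjoint)
    also have "\<dots> \<le> n - 1"
      using card_mono[of "{..<n - 1}" "A \<union> B"] sub by simp
    finally show False
      using cA cB deg \<open>l \<noteq> []\<close> by (auto simp: n_def Suc_le_eq neq_Nil_conv)
  qed
  then obtain i where i: "Suc i < length l" "(hd l, l ! Suc i) \<in> R" "(last l, l ! i) \<in> R"
    by (auto simp: A_def B_def n_def)
  show thesis
  proof (rule that[of "take (Suc i) l" "drop (Suc i) l"])
    show "(last (take (Suc i) l), last (drop (Suc i) l)) \<in> R"
      using i \<open>sym R\<close> by (auto simp: take_Suc_conv_app_nth dest: symD)
  qed (use i in \<open>auto simp: hd_drop_conv_nth\<close>)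
qed

lemma vwalk_arcs_split:
  assumes "(x, y) \<in> set (vwalk_arcs p)"
  shows "\<exists>P Q. p = P @ Q \<and> P \<noteq> [] \<and> Q \<noteq> [] \<and> x = last P \<and> y = hd Q"
  using assms
proof (induction p rule: vwalk_arcs.induct)
  case (3 u v p)
  show ?case
  proof (cases "(x, y) = (u, v)")
    case True
    then show ?thesis
      by (intro exI[of _ "[u]"] exI[of _ "v # p"]) auto
  next
    case False
    with 3 obtain P Q where "v # p = P @ Q" "P \<noteq> []" "Q \<noteq> []" "x = last P" "y = hd Q"
      by auto
    then show ?thesis
      by (intro exI[of _ "u # P"] exI[of _ Q]) auto
  qed
qed auto

text \<open>
  A gap can be rotated to the place where the list closes up. Its two ends are then nonadjacent,
  Ore's condition supplies two crossing chords, and reversing a segment removes the gap.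
\<close>

lemma ordering_with_fewer_gaps:
  assumes "distinct l" "R \<subseteq> set l \<times> set l" "sym R" "irrefl R" "length l \<ge> 2"
    and ore: "\<And>x y. x \<in> set l \<Longrightarrow> y \<in> set l \<Longrightarrow> x \<noteq> y \<Longrightarrow> (x, y) \<notin> R \<Longrightarrow>
           card (R `` {x}) + card (R `` {y}) \<ge> length l"
    and "gaps R l \<noteq> 0"
  obtains l' where "distinct l'" "set l' = set l" "gaps R l' < gaps R l"
proof -
  obtain m where m: "distinct m" "set m = set l" "gaps R m = gaps R l" "(last m, hd m) \<notin> R"
  proof -
    have "filter (\<lambda>e. e \<notin> R) (vwalk_arcs (l @ [hd l])) \<noteq> []"
      using \<open>gaps R l \<noteq> 0\<close> by (simp add: gaps_def misses_def)
    then obtain x y where xy: "(x, y) \<in> set (vwalk_arcs (l @ [hd l]))" "(x, y) \<notin> R"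
      by (auto simp: filter_empty_conv)
    from vwalk_arcs_split[OF xy(1)] obtain P Q where
      PQ: "l @ [hd l] = P @ Q" "P \<noteq> []" "Q \<noteq> []" "x = last P" "y = hd Q"
      by blast
    have l: "l = P @ butlast Q"
      using PQ by (metis butlast_append butlast_snoc)
    show thesis
    \<comment> \<open>in the first case the gap already is the step that closes up \<open>l\<close>\<close>
    proof (cases "butlast Q = []")
      case True
      with PQ(3) have "Q = [hd Q]"
        by (metis append_Nil append_butlast_last_id list.sel(1))
      with PQ(1) have "hd l = hd Q"
        by (metis last_snoc last_appendR last.simps list.distinct(1))
      with True l PQ have "last l = x" "hd l = y"
        by simp_all
      with xy show thesis
        by (intro that[of l]) (use assms in auto)
    next
      case False
      have "hd (butlast Q) = hd Q"
        using False by (cases Q) (auto split: if_splits)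
      with PQ xy l False show thesis
        by (intro that[of "butlast Q @ P"]) (use assms in \<open>auto simp: gaps_rotate\<close>)
    qed
  qed
  have len: "length m = length l"
    using m assms by (metis distinct_card)
  with \<open>length l \<ge> 2\<close> have "m \<noteq> []" by auto
  have "hd m \<noteq> last m"
    using len \<open>length l \<ge> 2\<close> \<open>distinct m\<close> by (cases m) auto
  with m \<open>m \<noteq> []\<close> have "(last m, hd m) \<notin> R" "last m \<in> set l" "hd m \<in> set l" "last m \<noteq> hd m"
    using last_in_set hd_in_set by metis+
  from ore[OF this(2-4,1)] have "card (R `` {hd m}) + card (R `` {last m}) \<ge> length m"
    by (simp add: len)
  then obtain P Q where PQ: "m = P @ Q" "P \<noteq> []" "Q \<noteq> []" "(hd P, hd Q) \<in> R" "(last P, last Q) \<in> R"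
    using crossing_chords[of m R] m(1,2) assms(2-4) \<open>m \<noteq> []\<close> by metis
  show thesis
  proof (rule that[of "P @ rev Q"])
    show "gaps R (P @ rev Q) < gaps R l"
      using gaps_reverse_less[of R P Q] PQ m assms(3) by auto
  qed (use PQ m in auto)
qed

lemma ore_ordering:
  assumes "finite V" "R \<subseteq> V \<times> V" "sym R" "irrefl R" "card V \<ge> 2"
    and ore: "\<And>x y. x \<in> V \<Longrightarrow> y \<in> V \<Longrightarrow> x \<noteq> y \<Longrightarrow> (x, y) \<notin> R \<Longrightarrow>
           card (R `` {x}) + card (R `` {y}) \<ge> card V"
  obtains l where "distinct l" "set l = V" "gaps R l = 0"
proof -
  obtain l where "distinct l \<and> set l = V"
    using finite_distinct_list[OF \<open>finite V\<close>] by auto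
  from ex_has_least_nat[of "\<lambda>l. distinct l \<and> set l = V", OF this, of "gaps R"]
  obtain l where l: "distinct l" "set l = V"
    and least: "\<And>l'. distinct l' \<Longrightarrow> set l' = V \<Longrightarrow> gaps R l \<le> gaps R l'"
    by blast
  have "gaps R l = 0"
  proof (rule ccontr)
    assume "gaps R l \<noteq> 0"
    moreover have "length l = card V"
      using l distinct_card by metis
    ultimately obtain l' where "distinct l'" "set l' = set l" "gaps R l' < gaps R l"
      using ordering_with_fewer_gaps[of l R] l assms(2-) by metis
    with l least show False
      by (metis leD)
  qed
  with l that show thesis by blast
qed

lemma pcas_vwalk_arcs: "pcas u (vwalk_arcs (u # p)) (last (u # p))"
  by (induction p arbitrary: u) auto

lemma pawalk_verts_vwalk_arcs: "pawalk_verts u (vwalk_arcs (u # p)) = u # p"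
  by (induction p arbitrary: u) auto

lemma fst_set_vwalk_arcs: "fst ` set (vwalk_arcs (p @ [z])) = set p"
  by (induction p rule: vwalk_arcs.induct) auto

text \<open>The closed vertex list \<open>l @ [hd l]\<close> is traversed as a walk of arcs.\<close>

lemma (in pair_pre_digraph) hamiltonian_if_ordering:
  assumes "distinct l" "set l = pverts G" "gaps (parcs G) l = 0" "l \<noteq> []"
  shows "hamiltonian G"
proof -
  obtain u p where l: "l = u # p"
    using \<open>l \<noteq> []\<close> by (cases l) auto
  let ?c = "vwalk_arcs (u # p @ [u])"
  have "set ?c \<subseteq> parcs G"
    using assms(3) by (auto simp: gaps_def misses_def l filter_empty_conv simp del: vwalk_arcs_Cons)
  moreover have "pcas u ?c u"
    using pcas_vwalk_arcs[of u "p @ [u]"] by simp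
  ultimately have "awalk u ?c u"
    using assms(2) l by (auto simp: awalk_def simp del: vwalk_arcs_Cons)
  moreover have "distinct (tl (pawalk_verts u ?c))"
    unfolding pawalk_verts_vwalk_arcs using assms(1) l by simp
  moreover have "?c \<noteq> []"
    by simp
  ultimately have "cycle ?c"
    unfolding cycle_def by blast
  moreover have "fst ` set ?c = pverts G"
    using fst_set_vwalk_arcs[of "u # p" u] assms(2) l by simp
  ultimately show ?thesis
    unfolding hamiltonian_def by blast
qed

lemma (in pair_graph) out_degree_conv_card: "out_degree G x = card (parcs G `` {x})"
proof -
  have "out_arcs G x = Pair x ` (parcs G `` {x})"
    by (auto simp: out_arcs_def)
  then show ?thesis
    unfolding out_degree_def by (simp add: card_image inj_on_def)
qed

lemma (in pair_graph) sym_parcs: "sym (parcs G)"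
  using pair_sym_arcs by (simp add: symmetric_def)

theorem (in pair_graph) ore:
  assumes "card (pverts G) \<ge> 2"
    and "\<And>x y. x \<in> pverts G \<Longrightarrow> y \<in> pverts G \<Longrightarrow> x \<noteq> y \<Longrightarrow> (x, y) \<notin> parcs G \<Longrightarrow>
           out_degree G x + out_degree G y \<ge> card (pverts G)"
  shows "hamiltonian G"
proof -
  have "irrefl (parcs G)"
    using pair_no_loops by (force simp: irrefl_def)
  moreover have "parcs G \<subseteq> pverts G \<times> pverts G"
    by (auto dest: wellformed')
  ultimately obtain l where "distinct l" "set l = pverts G" "gaps (parcs G) l = 0"
    using ore_ordering[OF pair_finite_verts _ sym_parcs _ assms(1)] assms(2)
    unfolding out_degree_conv_card by metis
  moreover from this have "l \<noteq> []"
    using assms(1) by auto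
  ultimately show ?thesis
    by (rule hamiltonian_if_ordering)
qed

section \<open>Recognising the listed induced subgraphs\<close>

definition induced :: "'a pair_pre_digraph \<Rightarrow> 'a set \<Rightarrow> 'a pair_pre_digraph" where
  "induced G S = \<lparr> pverts = S, parcs = parcs G \<inter> S \<times> S \<rparr>"

lemma (in pair_graph) induced_subgraph_induced:
  assumes "S \<subseteq> pverts G"
  shows "induced_subgraph (with_proj (induced G S)) (with_proj G)"
  unfolding induced_subgraph_def subgraph_def compatible_def
  using assms wf_digraph_axioms
  by (auto simp: induced_def wf_digraph_def)

lemma digraph_iso_with_projI:
  assumes "pair_wf_digraph H" "bij_betw f (pverts H) (pverts W)"
    and "parcs W \<subseteq> pverts W \<times> pverts W"
    and arcs: "\<And>u v. u \<in> pverts H \<Longrightarrow> v \<in> pverts H \<Longrightarrow> (u, v) \<in> parcs H \<longleftrightarrow> (f u, f v) \<in> parcs W"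
  shows "digraph_iso (with_proj H) (with_proj W)"
proof -
  interpret pair_wf_digraph H by fact
  let ?h = "\<lparr> iso_verts = f, iso_arcs = map_prod f f, iso_head = snd, iso_tail = fst \<rparr>"
  have inj: "inj_on f (pverts H)" and img: "f ` pverts H = pverts W"
    using assms(2) by (auto simp: bij_betw_def)
  have sub: "parcs H \<subseteq> pverts H \<times> pverts H"
    by (auto dest: wellformed')
  have "inj_on (map_prod f f) (parcs H)"
    using map_prod_inj_on[OF inj inj] sub by (rule inj_on_subset)
  then have "digraph_isomorphism ?h"
    using inj wf_digraph_axioms by (auto simp: digraph_isomorphism_def)
  moreover have "parcs W = map_prod f f ` parcs H"
  proof
    show "map_prod f f ` parcs H \<subseteq> parcs W"
      using arcs sub by auto
    show "parcs W \<subseteq> map_prod f f ` parcs H"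
    proof
      fix e assume e: "e \<in> parcs W"
      with assms(3) img obtain u v where "u \<in> pverts H" "v \<in> pverts H" "e = (f u, f v)"
        by (cases e) blast
      with e arcs show "e \<in> map_prod f f ` parcs H"
        by (auto intro!: rev_image_eqI)
    qed
  qed
  then have "with_proj W = app_iso ?h (with_proj H)"
    using img by (simp add: app_iso_def with_proj_def)
  ultimately show ?thesis
    unfolding digraph_iso_def by blast
qed

text \<open>
  By symmetry and the absence of loops, six comparisons of adjacency decide whether an enumeration
  of four vertices is an isomorphism onto a given graph.
\<close>

lemma (in pair_graph) digraph_iso_induced4:
  assumes abcd: "distinct [a, b, c, d]"
    and W: "pverts W = {p, q, r, s}" "distinct [p, q, r, s]"
      "parcs W \<subseteq> pverts W \<times> pverts W" "sym (parcs W)" "irrefl (parcs W)"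
    and "(a, b) \<in> parcs G \<longleftrightarrow> (p, q) \<in> parcs W" "(a, c) \<in> parcs G \<longleftrightarrow> (p, r) \<in> parcs W"
      "(a, d) \<in> parcs G \<longleftrightarrow> (p, s) \<in> parcs W" "(b, c) \<in> parcs G \<longleftrightarrow> (q, r) \<in> parcs W"
      "(b, d) \<in> parcs G \<longleftrightarrow> (q, s) \<in> parcs W" "(c, d) \<in> parcs G \<longleftrightarrow> (r, s) \<in> parcs W"
  shows "digraph_iso (with_proj (induced G {a, b, c, d})) (with_proj W)"
proof (rule digraph_iso_with_projI)
  let ?f = "(\<lambda>_. s)(a := p, b := q, c := r)"
  have swapG: "(v, u) \<in> parcs G \<longleftrightarrow> (u, v) \<in> parcs G" for u v
    using sym_parcs by (auto dest: symD)
  have swapW: "(v, u) \<in> parcs W \<longleftrightarrow> (u, v) \<in> parcs W" for u v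
    using W(4) by (auto dest: symD)
  have loopG: "(u, u) \<notin> parcs G" for u
    using pair_no_loops by force
  have loopW: "(u, u) \<notin> parcs W" for u
    using W(5) by (auto simp: irrefl_def)
  show "pair_wf_digraph (induced G {a, b, c, d})"
    by unfold_locales (auto simp: induced_def)
  show "bij_betw ?f (pverts (induced G {a, b, c, d})) (pverts W)"
    using abcd W(1,2) by (auto simp: bij_betw_def inj_on_def induced_def)
  show "(u, v) \<in> parcs (induced G {a, b, c, d}) \<longleftrightarrow> (?f u, ?f v) \<in> parcs W"
    if "u \<in> pverts (induced G {a, b, c, d})" "v \<in> pverts (induced G {a, b, c, d})" for u v
  proof -
    have "u \<in> {a, b, c, d}" "v \<in> {a, b, c, d}"
      using that by (simp_all add: induced_def)
    then show ?thesis
      using abcd assms(7-12) swapG swapW loopG loopW unfolding induced_def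
      by (elim insertE emptyE) (simp_all, metis+)
  qed
qed fact

text \<open>
  Forbidden, that is, as an induced subgraph that contains a nonadjacent pair of degree sum less
  than the number of vertices.
\<close>

definition forbidden :: "'a pair_pre_digraph \<Rightarrow> bool" where
  "forbidden H \<longleftrightarrow>
     digraph_iso (with_proj H)
       (with_proj (disjoint_union (complete_bipartite_graph 1 2) (complete_graph 1))) \<or>
     digraph_iso (with_proj H)
       (with_proj (disjoint_union (complete_graph 3) (complete_graph 1))) \<or>
     digraph_iso (with_proj H) (with_proj (complete_bipartite_graph 1 3)) \<or>
     (\<exists>W. edge_addition (complete_bipartite_graph 1 3) W \<and>
          digraph_iso (with_proj H) (with_proj W)) \<or>
     digraph_iso (with_proj H) (with_proj (path_graph 4))"

lemma pverts_disjoint_union: "pverts (disjoint_union A B) = Inl ` pverts A \<union> Inr ` pverts B"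
  by (auto simp: disjoint_union_def)

lemma parcs_disjoint_union:
  "parcs (disjoint_union A B) =
     {(Inl u, Inl v) |u v. (u, v) \<in> parcs A} \<union> {(Inr u, Inr v) |u v. (u, v) \<in> parcs B}"
  unfolding disjoint_union_def by (force simp: map_prod_def)

context pair_graph
begin

lemma forbidden_cherry:
  assumes "distinct [a, b, c, d]" "(a, b) \<in> parcs G" "(a, c) \<in> parcs G" "(b, c) \<notin> parcs G"
    "(a, d) \<notin> parcs G" "(b, d) \<notin> parcs G" "(c, d) \<notin> parcs G"
  shows "forbidden (induced G {a, b, c, d})"
proof -
  let ?W = "disjoint_union (complete_bipartite_graph 1 2) (complete_graph 1)"
  have "digraph_iso (with_proj (induced G {a, b, c, d})) (with_proj ?W)"
    by (rule digraph_iso_induced4[OF assms(1), of ?W "Inl (Inl 0)" "Inl (Inr 0)" "Inl (Inr 1)" "Inr 0"])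
      (use assms in \<open>auto simp: pverts_disjoint_union parcs_disjoint_union complete_bipartite_graph_def complete_graph_def
          sym_def irrefl_def\<close>)
  then show ?thesis unfolding forbidden_def by blast
qed

lemma forbidden_triangle:
  assumes "distinct [a, b, c, d]" "(a, b) \<in> parcs G" "(a, c) \<in> parcs G" "(b, c) \<in> parcs G"
    "(a, d) \<notin> parcs G" "(b, d) \<notin> parcs G" "(c, d) \<notin> parcs G"
  shows "forbidden (induced G {a, b, c, d})"
proof -
  let ?W = "disjoint_union (complete_graph 3) (complete_graph 1)"
  have "digraph_iso (with_proj (induced G {a, b, c, d})) (with_proj ?W)"
    by (rule digraph_iso_induced4[OF assms(1), of ?W "Inl 0" "Inl 1" "Inl 2" "Inr 0"])
      (use assms in \<open>auto simp: pverts_disjoint_union parcs_disjoint_union complete_graph_def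
          sym_def irrefl_def\<close>)
  then show ?thesis unfolding forbidden_def by blast
qed

lemma forbidden_claw:
  assumes "distinct [a, b, c, d]" "(a, b) \<in> parcs G" "(a, c) \<in> parcs G" "(a, d) \<in> parcs G"
    "(b, c) \<notin> parcs G" "(b, d) \<notin> parcs G" "(c, d) \<notin> parcs G"
  shows "forbidden (induced G {a, b, c, d})"
proof -
  let ?W = "complete_bipartite_graph 1 3"
  have "digraph_iso (with_proj (induced G {a, b, c, d})) (with_proj ?W)"
    by (rule digraph_iso_induced4[OF assms(1), of ?W "Inl 0" "Inr 0" "Inr 1" "Inr 2"])
      (use assms in \<open>auto simp: complete_bipartite_graph_def sym_def irrefl_def\<close>)
  then show ?thesis unfolding forbidden_def by blast
qed

lemma forbidden_paw:
  assumes "distinct [a, b, c, d]" "(a, b) \<in> parcs G" "(a, c) \<in> parcs G" "(a, d) \<in> parcs G"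
    "(b, c) \<in> parcs G" "(b, d) \<notin> parcs G" "(c, d) \<notin> parcs G"
  shows "forbidden (induced G {a, b, c, d})"
proof -
  \<comment> \<open>the claw with centre \<open>Inl 0\<close>, and an edge between two of its leaves\<close>
  let ?K = "complete_bipartite_graph 1 3"
  let ?W = "\<lparr> pverts = pverts ?K, parcs = parcs ?K \<union> {(Inr 0, Inr 1), (Inr 1, Inr 0)} \<rparr>"
  have "digraph_iso (with_proj (induced G {a, b, c, d})) (with_proj ?W)"
    by (rule digraph_iso_induced4[OF assms(1), of ?W "Inl 0" "Inr 0" "Inr 1" "Inr 2"])
      (use assms in \<open>auto simp: complete_bipartite_graph_def sym_def irrefl_def\<close>)
  moreover have "edge_addition ?K ?W"
    unfolding edge_addition_def
    by (intro bexI[of _ "Inr 0"] bexI[of _ "Inr 1"]) (auto simp: complete_bipartite_graph_def)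
  ultimately show ?thesis unfolding forbidden_def by blast
qed

lemma forbidden_path:
  assumes "distinct [a, b, c, d]" "(a, b) \<in> parcs G" "(b, c) \<in> parcs G" "(c, d) \<in> parcs G"
    "(a, c) \<notin> parcs G" "(a, d) \<notin> parcs G" "(b, d) \<notin> parcs G"
  shows "forbidden (induced G {a, b, c, d})"
proof -
  have "digraph_iso (with_proj (induced G {a, b, c, d})) (with_proj (path_graph 4))"
    by (rule digraph_iso_induced4[OF assms(1), of "path_graph 4" 0 1 2 3])
      (use assms in \<open>auto simp: path_graph_def sym_def irrefl_def\<close>)
  then show ?thesis unfolding forbidden_def by blast
qed

section \<open>Pairs that lie in none of the listed subgraphs\<close>

text \<open>
  A nonadjacent pair that violates Ore's condition is such a pair, because the hypothesis of the
  theorem would bound its degree sum from below otherwise.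
\<close>

definition free_pair :: "'a \<Rightarrow> 'a \<Rightarrow> bool" where
  "free_pair x y \<longleftrightarrow> x \<in> pverts G \<and> y \<in> pverts G \<and> x \<noteq> y \<and> (x, y) \<notin> parcs G \<and>
     (\<forall>u \<in> pverts G. \<forall>w \<in> pverts G. distinct [x, y, u, w] \<longrightarrow> \<not> forbidden (induced G {x, y, u, w}))"

lemma adj_commute: "(u, v) \<in> parcs G \<longleftrightarrow> (v, u) \<in> parcs G"
  using sym_parcs by (auto dest: symD)

lemma free_pair_commute: "free_pair x y \<longleftrightarrow> free_pair y x"
  unfolding free_pair_def by (auto simp: adj_commute[of x y] insert_commute)

lemma free_pairD:
  assumes "free_pair x y" "u \<in> pverts G" "w \<in> pverts G" "distinct [x, y, u, w]"
  shows "\<not> forbidden (induced G {x, y, u, w})"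
  using assms by (auto simp: free_pair_def)

text \<open>
  If \<open>u\<close> is adjacent to both \<open>x\<close> and \<open>y\<close> but \<open>w\<close> is not adjacent to \<open>x\<close>, then the edges \<open>y w\<close> and
  \<open>u w\<close> may or may not be present, and each of the four cases gives a listed graph: the paw, the
  path, the claw, or \<open>K\<^sub>1\<^sub>,\<^sub>2 \<union> K\<^sub>1\<close>. Exchanging \<open>x\<close> and \<open>y\<close> shows that \<open>w\<close> is adjacent to \<open>y\<close> as well.
\<close>

lemma free_pair_common_neighbour_all:
  assumes xy: "free_pair x y" and u: "(u, x) \<in> parcs G" "(u, y) \<in> parcs G"
    and w: "w \<in> pverts G" "w \<noteq> x" "w \<noteq> y"
  shows "(x, w) \<in> parcs G"
proof (rule ccontr)
  assume xw: "(x, w) \<notin> parcs G"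
  have nxy: "(x, y) \<notin> parcs G" "x \<noteq> y"
    using xy by (auto simp: free_pair_def)
  have uV: "u \<in> pverts G" "u \<noteq> x" "u \<noteq> y" "u \<noteq> w"
    using u xw pair_no_loops adj_commute wellformed' by force+
  have dist: "distinct [x, y, u, w]"
    using nxy w uV by auto
  note free = free_pairD[OF xy uV(1) w(1) dist]
  note adj = u xw nxy adj_commute
  show False
  proof (cases "(y, w) \<in> parcs G")
    case yw: True
    show False
    proof (cases "(u, w) \<in> parcs G")
      case True
      have "forbidden (induced G {u, y, w, x})"
        by (rule forbidden_paw) (use adj yw True dist in auto)
      then show False using free by (simp add: insert_commute)
    next
      case False
      have "forbidden (induced G {x, u, y, w})"
        by (rule forbidden_path) (use adj yw False dist in auto)
      then show False using free by (simp add: insert_commute)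
    qed
  next
    case yw: False
    show False
    proof (cases "(u, w) \<in> parcs G")
      case True
      have "forbidden (induced G {u, x, y, w})"
        by (rule forbidden_claw) (use adj yw True dist in auto)
      then show False using free by (simp add: insert_commute)
    next
      case False
      have "forbidden (induced G {u, x, y, w})"
        by (rule forbidden_cherry) (use adj yw False dist in auto)
      then show False using free by (simp add: insert_commute)
    qed
  qed
qed

text \<open>
  Two neighbours of \<open>x\<close> that are not adjacent to \<open>y\<close> form, with \<open>x\<close>, a triangle or a \<open>K\<^sub>1\<^sub>,\<^sub>2\<close>
  to which \<open>y\<close> is not joined.
\<close>

lemma free_pair_private_neighbour_unique:
  assumes xy: "free_pair x y" and u: "(x, u) \<in> parcs G" "(y, u) \<notin> parcs G"
    and w: "(x, w) \<in> parcs G" "(y, w) \<notin> parcs G"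
  shows "u = w"
proof (rule ccontr)
  assume "u \<noteq> w"
  have nxy: "(x, y) \<notin> parcs G" "x \<noteq> y"
    using xy by (auto simp: free_pair_def)
  have V: "u \<in> pverts G" "w \<in> pverts G"
    using u w wellformed' by blast+
  have dist: "distinct [x, y, u, w]"
    using nxy u w \<open>u \<noteq> w\<close> pair_no_loops by force
  note adj = u w nxy adj_commute
  have "forbidden (induced G {x, u, w, y})"
  proof (cases "(u, w) \<in> parcs G")
    case True
    show ?thesis
      by (rule forbidden_triangle) (use adj True dist in auto)
  next
    case False
    show ?thesis
      by (rule forbidden_cherry) (use adj False dist in auto)
  qed
  then show False
    using free_pairD[OF xy V dist] by (simp add: insert_commute)
qed

text \<open>
  If \<open>u\<close> and \<open>w\<close> were adjacent, \<open>x\<close>, \<open>u\<close>, \<open>w\<close> would be an induced path, and with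
  \<open>y\<close> it would become \<open>P\<^sub>4\<close> or \<open>K\<^sub>1\<^sub>,\<^sub>2 \<union> K\<^sub>1\<close>, according to whether \<open>y\<close> is adjacent to \<open>w\<close>.
\<close>

lemma free_pair_private_neighbour_isolated:
  assumes xy: "free_pair x y" and u: "(x, u) \<in> parcs G" "(y, u) \<notin> parcs G"
    and w: "(x, w) \<notin> parcs G" "w \<noteq> x"
  shows "(u, w) \<notin> parcs G"
proof
  assume uw: "(u, w) \<in> parcs G"
  have nxy: "(x, y) \<notin> parcs G" "x \<noteq> y"
    using xy by (auto simp: free_pair_def)
  have V: "u \<in> pverts G" "w \<in> pverts G"
    using u uw wellformed' by blast+
  have "w \<noteq> y"
    using u(2) uw adj_commute by blast
  then have dist: "distinct [x, y, u, w]"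
    using nxy u w uw pair_no_loops by force
  note adj = u w nxy uw adj_commute
  have "forbidden (induced G {x, y, u, w})"
  proof (cases "(y, w) \<in> parcs G")
    case True
    have "forbidden (induced G {x, u, w, y})"
      by (rule forbidden_path) (use adj True dist in auto)
    then show ?thesis by (simp add: insert_commute)
  next
    case False
    have "forbidden (induced G {u, x, w, y})"
      by (rule forbidden_cherry) (use adj False dist in auto)
    then show ?thesis by (simp add: insert_commute)
  qed
  then show False
    using free_pairD[OF xy V dist] by simp
qed

lemma finite_neighbours: "finite (parcs G `` {x})"
  by (rule finite_subset[OF _ pair_finite_verts]) (auto dest: wellformed')

lemma degree_sum_if_common_neighbour:
  assumes xy: "free_pair x y" and u: "(u, x) \<in> parcs G" "(u, y) \<in> parcs G"
    and "card (pverts G) \<ge> 4"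
  shows "out_degree G x + out_degree G y \<ge> card (pverts G)"
proof -
  have V: "x \<in> pverts G" "y \<in> pverts G" "x \<noteq> y"
    using xy by (auto simp: free_pair_def)
  have "pverts G - {x, y} \<subseteq> parcs G `` {x}" "pverts G - {x, y} \<subseteq> parcs G `` {y}"
    using free_pair_common_neighbour_all[OF xy u]
      free_pair_common_neighbour_all[OF xy[unfolded free_pair_commute[of x]] u(2,1)] by auto
  then have "card (pverts G - {x, y}) \<le> out_degree G x" "card (pverts G - {x, y}) \<le> out_degree G y"
    unfolding out_degree_conv_card by (auto intro!: card_mono finite_neighbours)
  moreover have "card (pverts G - {x, y}) = card (pverts G) - 2"
    using V pair_finite_verts by (simp add: card_Diff_subset)
  ultimately show ?thesis
    using assms(4) by linarith
qed

lemma degree_le_1_if_no_common_neighbour: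
  assumes xy: "free_pair x y" and none: "\<And>u. \<not> ((u, x) \<in> parcs G \<and> (u, y) \<in> parcs G)"
  shows "out_degree G x \<le> 1"
proof -
  have "u = w" if "(x, u) \<in> parcs G" "(x, w) \<in> parcs G" for u w
    using free_pair_private_neighbour_unique[OF xy] that none adj_commute by metis
  then show ?thesis
    unfolding out_degree_conv_card by (auto simp: card_le_Suc0_iff_eq[OF finite_neighbours])
qed

text \<open>
  If \<open>v\<close> were adjacent to \<open>x\<close>, another neighbour \<open>c\<close> of \<open>v\<close> would be adjacent to \<open>x\<close>, because the
  private neighbour \<open>v\<close> of \<open>x\<close> has no neighbours outside the closed neighbourhood of \<open>x\<close>. But \<open>v\<close>
  is the only neighbour of \<open>x\<close>.
\<close>

lemma free_pair_not_adjacent_to_degree_2: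
  assumes xy: "free_pair x y" and none: "\<And>u. \<not> ((u, x) \<in> parcs G \<and> (u, y) \<in> parcs G)"
    and v: "(v, a) \<in> parcs G" "(v, b) \<in> parcs G" "a \<noteq> b"
  shows "(x, v) \<notin> parcs G"
proof
  assume xv: "(x, v) \<in> parcs G"
  obtain c where c: "(v, c) \<in> parcs G" "c \<noteq> x"
    using v by metis
  have yv: "(y, v) \<notin> parcs G"
    using none[of v] xv adj_commute by blast
  have "(x, c) \<in> parcs G"
    using free_pair_private_neighbour_isolated[OF xy xv yv _ c(2)] c(1) by blast
  then have "c = v"
    using free_pair_private_neighbour_unique[OF xy _ _ xv yv] none adj_commute by metis
  with c(1) pair_no_loops show False by force
qed

section \<open>The hypothesis implies Ore's condition\<close>

lemma degree_sum_nonadjacent: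
  assumes "card (pverts G) \<ge> 4"
    and forb: "\<And>S x y. S \<subseteq> pverts G \<Longrightarrow> forbidden (induced G S) \<Longrightarrow> x \<in> S \<Longrightarrow> y \<in> S \<Longrightarrow>
      x \<noteq> y \<Longrightarrow> (x, y) \<notin> parcs G \<Longrightarrow> out_degree G x + out_degree G y \<ge> card (pverts G)"
    and v: "v \<in> pverts G" "out_degree G v \<ge> 2"
    and xy: "x \<in> pverts G" "y \<in> pverts G" "x \<noteq> y" "(x, y) \<notin> parcs G"
  shows "out_degree G x + out_degree G y \<ge> card (pverts G)"
proof (rule ccontr)
  assume less: "\<not> ?thesis"
  have free: "free_pair x y"
    unfolding free_pair_def
  proof (intro conjI ballI impI notI)
    fix u w assume "u \<in> pverts G" "w \<in> pverts G" "forbidden (induced G {x, y, u, w})"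
    with forb[of "{x, y, u, w}" x y] xy less show False by auto
  qed (use xy in auto)
  then have free': "free_pair y x"
    by (simp add: free_pair_commute)
  have none: "\<not> ((u, x) \<in> parcs G \<and> (u, y) \<in> parcs G)" for u
    using degree_sum_if_common_neighbour[OF free _ _ assms(1)] less by blast
  then have none': "\<not> ((u, y) \<in> parcs G \<and> (u, x) \<in> parcs G)" for u
    by blast
  have deg: "out_degree G x \<le> 1" "out_degree G y \<le> 1"
    using degree_le_1_if_no_common_neighbour free free' none none' by metis+
  with v have vxy: "v \<noteq> x" "v \<noteq> y" by auto
  obtain a b where ab: "(v, a) \<in> parcs G" "(v, b) \<in> parcs G" "a \<noteq> b"
    using v(2) card_le_Suc0_iff_eq[OF finite_neighbours, of v]
    unfolding out_degree_conv_card by force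
  have xv: "(x, v) \<notin> parcs G" "(y, v) \<notin> parcs G"
    using free_pair_not_adjacent_to_degree_2[OF _ _ ab] free free' none none' by metis+
  \<comment> \<open>as \<open>v\<close> is not adjacent to \<open>x\<close>, it is not adjacent to a neighbour of \<open>x\<close> either\<close>
  have far: "(x, c) \<notin> parcs G" if "(v, c) \<in> parcs G" for c
    using free_pair_private_neighbour_isolated[OF free _ _ xv(1) vxy(1)] that none adj_commute
    by metis
  have V: "a \<in> pverts G" "b \<in> pverts G"
    using ab wellformed' by blast+
  have dist: "distinct [v, a, b, x]"
    using vxy ab xv adj_commute pair_no_loops by force
  have "forbidden (induced G {v, a, b, x})"
  proof (cases "(a, b) \<in> parcs G")
    case True
    show ?thesis
      by (rule forbidden_triangle) (use dist ab True xv far adj_commute in auto)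
  next
    case False
    show ?thesis
      by (rule forbidden_cherry) (use dist ab False xv far adj_commute in auto)
  qed
  then have "out_degree G x + out_degree G v \<ge> card (pverts G)"
    using forb[of "{v, a, b, x}" x v] V v xy(1) xv vxy by auto
  \<comment> \<open>\<open>v\<close> is adjacent neither to itself nor to \<open>x\<close> or \<open>y\<close>\<close>
  moreover have "out_degree G v \<le> card (pverts G - {v, x, y})"
    unfolding out_degree_conv_card
    using xv adj_commute pair_no_loops wellformed' pair_finite_verts
    by (intro card_mono) force+
  moreover have "card (pverts G - {v, x, y}) = card (pverts G) - 3"
    using v xy vxy pair_finite_verts by (simp add: card_Diff_subset)
  ultimately show False
    using deg assms(1) by linarith
qed

end

theorem theorem1:
  fixes G :: "'a pair_pre_digraph" and n :: nat
  assumes "pair_graph G"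
    and "card (pverts G) = n"
    and "n \<ge> 4"
    and "\<And>(H :: 'a pair_pre_digraph) x y.
           induced_subgraph (with_proj H) (with_proj G) \<Longrightarrow>
           digraph_iso (with_proj H)
             (with_proj (disjoint_union (complete_bipartite_graph 1 2) (complete_graph 1))) \<or>
           digraph_iso (with_proj H)
             (with_proj (disjoint_union (complete_graph 3) (complete_graph 1))) \<or>
           digraph_iso (with_proj H) (with_proj (complete_bipartite_graph 1 3)) \<or>
           (\<exists>W. edge_addition (complete_bipartite_graph 1 3) W \<and>
                digraph_iso (with_proj H) (with_proj W)) \<or>
           digraph_iso (with_proj H) (with_proj (path_graph 4)) \<Longrightarrow>
           x \<in> pverts H \<Longrightarrow> y \<in> pverts H \<Longrightarrow> x \<noteq> y \<Longrightarrow> (x, y) \<notin> parcs H \<Longrightarrow>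
           out_degree (with_proj G) x + out_degree (with_proj G) y \<ge> n"
    and "\<exists>v \<in> pverts G. out_degree (with_proj G) v \<ge> 2"
  shows "hamiltonian G"
proof -
  interpret pair_graph G by fact
  note n = \<open>card (pverts G) = n\<close>
  have forb: "out_degree G x + out_degree G y \<ge> card (pverts G)"
    if "S \<subseteq> pverts G" "forbidden (induced G S)" "x \<in> S" "y \<in> S" "x \<noteq> y" "(x, y) \<notin> parcs G"
    for S x y
    using assms(4)[OF induced_subgraph_induced[OF that(1)] that(2)[unfolded forbidden_def], of x y]
      that n by (simp add: induced_def)
  obtain v where "v \<in> pverts G" "out_degree G v \<ge> 2"
    using assms(5) by blast
  then show ?thesis
    using ore degree_sum_nonadjacent[OF _ forb] \<open>n \<ge> 4\<close> n by simp
qed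

end
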